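(* Let $n,m,s,k\ge 1$ be integers, let $A\in\mathbb{R}^{n\times n}$, $B\in\mathbb{R}^{m\times m}$, $C_1\in\mathbb{R}^{n\times s}$, $C_2\in\mathbb{R}^{m\times s}$, and put $\mathcal{F}:=I_m\otimes A+B^\top\otimes I_n$ and $\bm{c}:=\mathrm{vec}(C_1C_2^\top)$. Let $\mathcal{V}_k\in\mathbb{R}^{n\times ks}$ and $\mathcal{W}_k\in\mathbb{R}^{m\times ks}$ be matrices whose columns form orthonormal bases of the block Krylov subspaces $\mathcal{K}_k^\square(A,C_1)$ and $\mathcal{K}_k^\square(B^\top,C_2)$, respectively. Then for every $Z\in\mathbb{R}^{n\times m}$ with $\mathrm{vec}(Z)\in\mathcal{K}_k(\mathcal{F},\bm{c})$ there exists a matrix $\mathbf{Z}\in\mathbb{R}^{ks\times ks}$ such that $$Z=\mathcal{V}_k\mathbf{Z}\mathcal{W}_k^\top.$$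
   Context: $I_n$ is the $n\times n$ identity matrix, $\otimes$ the Kronecker product, and $\mathrm{vec}:\mathbb{R}^{n\times m}\to\mathbb{R}^{mn}$ stacks the columns of a matrix on top of each other. The Krylov subspace is $\mathcal{K}_k(\mathcal{F},\bm{c}):=\mathrm{span}(\bm{c},\mathcal{F}\bm{c},\ldots,\mathcal{F}^{k-1}\bm{c})$. The block Krylov subspace $\mathcal{K}_k^\square(A,C_1)\subseteq\mathbb{R}^n$ is the range (column space) of $[C_1,AC_1,\ldots,A^{k-1}C_1]$, and $\mathcal{K}_k^\square(B^\top,C_2)\subseteq\mathbb{R}^m$ is the range of $[C_2,B^\top C_2,\ldots,(B^\top)^{k-1}C_2]$. *)

theory Defs
  imports "Jordan_Normal_Form.VS_Connect"
begin

definition kronecker_prod :: "real mat \<Rightarrow> real mat \<Rightarrow> real mat" (infixl \<open>\<otimes>\<^sub>K\<close> 70) where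
  "P \<otimes>\<^sub>K Q = mat (dim_row P * dim_row Q) (dim_col P * dim_col Q)
     (\<lambda>(i, j). P $$ (i div dim_row Q, j div dim_col Q) * Q $$ (i mod dim_row Q, j mod dim_col Q))"

text \<open>Column-major: entry \<open>(i, j)\<close> of \<open>M\<close> lands in position \<open>j * dim_row M + i\<close>.\<close>

definition vectorize :: "real mat \<Rightarrow> real vec" where
  "vectorize M = vec (dim_row M * dim_col M) (\<lambda>l. M $$ (l mod dim_row M, l div dim_row M))"

abbreviation real_vec_space :: "nat \<Rightarrow> (real, real vec) module" where
  "real_vec_space n \<equiv> module_vec TYPE(real) n"

definition krylov_space :: "nat \<Rightarrow> real mat \<Rightarrow> real vec \<Rightarrow> real vec set" where
  "krylov_space k F c =
     LinearCombinations.module.span class_ring (real_vec_space (dim_vec c))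
       {(F ^\<^sub>m j) *\<^sub>v c | j. j < k}"

definition krylov_block_mat :: "nat \<Rightarrow> real mat \<Rightarrow> real mat \<Rightarrow> real mat" where
  "krylov_block_mat k A C = mat_of_cols (dim_row C) (concat (map (\<lambda>j. cols (A ^\<^sub>m j * C)) [0..<k]))"

definition block_krylov_space :: "nat \<Rightarrow> real mat \<Rightarrow> real mat \<Rightarrow> real vec set" where
  "block_krylov_space k A C = vec_space.col_space (dim_row C) (krylov_block_mat k A C)"

text \<open>Orthonormality is stated for the indexed family of columns, so it also rules out repeated
  columns, which \<open>set (cols V)\<close> alone would not detect.\<close>

definition cols_orthonormal_basis :: "real mat \<Rightarrow> real vec set \<Rightarrow> bool" where
  "cols_orthonormal_basis V S \<longleftrightarrow>
     (\<forall>i < dim_col V. \<forall>j < dim_col V. col V i \<bullet> col V j = (if i = j then 1 else 0)) \<and>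
     \<not> LinearCombinations.module.lin_dep class_ring (real_vec_space (dim_row V)) (set (cols V)) \<and>
     LinearCombinations.module.span class_ring (real_vec_space (dim_row V)) (set (cols V)) = S"

end

theory Submission
  imports Defs
begin

text \<open>Under \<open>vectorize\<close>, multiplication by the Kronecker sum \<open>F\<close> is the Sylvester operator
  \<open>X \<mapsto> A X + X B\<close> (\<open>kronecker_sum_mult_vectorize\<close>). Write \<open>M i l\<close> for
  \<open>(A^i C1) ((B\<^sup>T)^l C2)\<^sup>T = A^i C1 C2\<^sup>T B^l\<close>. The Sylvester operator sends \<open>M i l\<close> to
  \<open>M (i+1) l + M i (l+1)\<close>, so \<open>j\<close> applications to \<open>M 0 0 = C1 C2\<^sup>T\<close> produce a combination of
  matrices \<open>M i l\<close> with \<open>i + l = j\<close>. Every \<open>j\<close> that occurs in the Krylov space is below \<open>k\<close>, and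
  so are all these exponents.

  For \<open>i < k\<close> the columns of \<open>A^i C1\<close> lie in the first block Krylov space, which the columns of
  \<open>V\<close> span; hence \<open>A^i C1 = V X\<close> for some \<open>X\<close>, and likewise \<open>(B\<^sup>T)^l C2 = W Y\<close>
  (\<open>pow_mult_factors_through_basis\<close>). Therefore \<open>M i l = V (X Y\<^sup>T) W\<^sup>T\<close>. The matrices of the form
  \<open>V Y W\<^sup>T\<close> are a linear subspace (\<open>submodule_vectorize_compressible\<close>), so vectorizing them gives
  a subspace that contains every generator \<open>F^j c\<close> with \<open>j < k\<close>
  (\<open>kronecker_sum_power_compressible\<close>), and with them the whole Krylov space. Injectivity of
  \<open>vectorize\<close> on \<open>n \<times> m\<close> matrices turns this back into a statement about \<open>Z\<close>.\<close>

section \<open>Vectorization and the Kronecker product\<close>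

lemma sum_mult_eq_double_sum:
  fixes f :: "nat \<Rightarrow> 'a::comm_monoid_add"
  shows "(\<Sum>l<m * n. f l) = (\<Sum>b<m. \<Sum>a<n. f (b * n + a))"
proof -
  have "sum f {b * n..<b * n + n} = (\<Sum>a<n. f (b * n + a))" for b
    using sum.shift_bounds_nat_ivl[of f 0 "b * n" n] by (simp add: lessThan_atLeast0 add.commute)
  then show ?thesis by (simp add: sum.nat_group[of f n m, symmetric])
qed

lemma vectorize_carrier:
  assumes "M \<in> carrier_mat n m"
  shows "vectorize M \<in> carrier_vec (n * m)"
  using assms by (auto simp: vectorize_def)

lemma vectorize_index:
  assumes "M \<in> carrier_mat n m" and "i < n" and "j < m"
  shows "vectorize M $ (j * n + i) = M $$ (i, j)"
proof -
  have "j * n + i < n * m"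
    by (metis assms(2,3) mult.commute mult_Suc add.commute less_le_trans nat_add_left_cancel_less
        Suc_leI mult_le_mono1)
  with assms show ?thesis by (simp add: vectorize_def)
qed

lemma vectorize_inj:
  assumes M: "M \<in> carrier_mat n m" and N: "N \<in> carrier_mat n m"
    and eq: "vectorize M = vectorize N"
  shows "M = N"
proof (rule eq_matI)
  fix i j assume "i < dim_row N" "j < dim_col N"
  then have "i < n" "j < m" using N by auto
  then show "M $$ (i, j) = N $$ (i, j)"
    using vectorize_index[OF M] vectorize_index[OF N] eq by metis
qed (use M N in auto)

lemma vec_index_bounds:
  fixes n m l :: nat
  assumes "l < n * m"
  shows "l mod n < n" and "l div n < m"
proof -
  have "n > 0" using assms by (cases n) auto
  then show "l mod n < n" by simp
  show "l div n < m" using assms by (simp add: less_mult_imp_div_less mult.commute)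
qed

lemma vectorize_add:
  assumes "M \<in> carrier_mat n m" and "N \<in> carrier_mat n m"
  shows "vectorize (M + N) = vectorize M + vectorize N"
  using assms by (intro eq_vecI) (auto simp: vectorize_def vec_index_bounds)

lemma vectorize_smult:
  assumes "M \<in> carrier_mat n m"
  shows "vectorize (c \<cdot>\<^sub>m M) = c \<cdot>\<^sub>v vectorize M"
  using assms by (intro eq_vecI) (auto simp: vectorize_def vec_index_bounds)

lemma vectorize_zero: "vectorize (0\<^sub>m n m) = 0\<^sub>v (n * m)"
  by (intro eq_vecI) (auto simp: vectorize_def vec_index_bounds)

lemma kronecker_prod_carrier:
  assumes "P \<in> carrier_mat p m" and "Q \<in> carrier_mat q n"
  shows "P \<otimes>\<^sub>K Q \<in> carrier_mat (p * q) (m * n)"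
  using assms by (auto simp: kronecker_prod_def)

text \<open>In column-major order, splitting the summation index of the matrix-vector product by division
  with remainder by \<open>n\<close> turns it into a double sum over the columns and rows of \<open>X\<close>, which is the
  entry of \<open>Q X P\<^sup>T\<close>.\<close>

lemma kronecker_prod_mult_vectorize:
  assumes P: "P \<in> carrier_mat p m" and Q: "Q \<in> carrier_mat q n" and X: "X \<in> carrier_mat n m"
  shows "(P \<otimes>\<^sub>K Q) *\<^sub>v vectorize X = vectorize (Q * X * P\<^sup>T)"
proof (rule eq_vecI)
  fix r assume "r < dim_vec (vectorize (Q * X * P\<^sup>T))"
  then have r: "r < q * p" using P Q by (simp add: vectorize_def)
  define i j where "i = r mod q" and "j = r div q"
  have ij: "i < q" "j < p" using vec_index_bounds[OF r] by (auto simp: i_def j_def)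
  \<comment> \<open>Position \<open>r\<close> of the vectorized \<open>q \<times> p\<close> matrix holds its entry \<open>(i, j)\<close>.\<close>
  have KP: "(P \<otimes>\<^sub>K Q) $$ (r, l) = P $$ (j, l div n) * Q $$ (i, l mod n)" if "l < m * n" for l
    using r that P Q by (simp add: kronecker_prod_def i_def j_def mult.commute)
  have bound: "b * n + a < m * n" if "a < n" "b < m" for a b
    by (metis that mult_Suc add.commute less_le_trans nat_add_left_cancel_less
        Suc_leI mult_le_mono1)
  have "((P \<otimes>\<^sub>K Q) *\<^sub>v vectorize X) $ r = (\<Sum>l<m * n. (P \<otimes>\<^sub>K Q) $$ (r, l) * vectorize X $ l)"
    using r kronecker_prod_carrier[OF P Q] vectorize_carrier[OF X]
    by (simp add: scalar_prod_def mult.commute lessThan_atLeast0)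
  also have "\<dots> = (\<Sum>b<m. \<Sum>a<n. (P \<otimes>\<^sub>K Q) $$ (r, b * n + a) * vectorize X $ (b * n + a))"
    by (rule sum_mult_eq_double_sum)
  also have "\<dots> = (\<Sum>b<m. \<Sum>a<n. Q $$ (i, a) * X $$ (a, b) * P $$ (j, b))"
    using bound by (intro sum.cong refl) (simp add: KP vectorize_index[OF X])
  also have "\<dots> = (Q * X * P\<^sup>T) $$ (i, j)"
    using ij P Q X by (simp add: scalar_prod_def lessThan_atLeast0 sum_distrib_right del: assoc_mult_mat)
  also have "\<dots> = vectorize (Q * X * P\<^sup>T) $ r"
    using r P Q by (simp add: vectorize_def i_def j_def)
  finally show "((P \<otimes>\<^sub>K Q) *\<^sub>v vectorize X) $ r = vectorize (Q * X * P\<^sup>T) $ r" .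
qed (use P Q in \<open>simp add: kronecker_prod_def vectorize_def\<close>)

lemma kronecker_sum_carrier:
  assumes "A \<in> carrier_mat n n" and "B \<in> carrier_mat m m"
  shows "1\<^sub>m m \<otimes>\<^sub>K A + B\<^sup>T \<otimes>\<^sub>K 1\<^sub>m n \<in> carrier_mat (n * m) (n * m)"
  using kronecker_prod_carrier[of "1\<^sub>m m" m m A n n] kronecker_prod_carrier[of "B\<^sup>T" m m "1\<^sub>m n" n n] assms
  by (simp add: mult.commute)

lemma kronecker_sum_mult_vectorize:
  assumes A: "A \<in> carrier_mat n n" and B: "B \<in> carrier_mat m m" and X: "X \<in> carrier_mat n m"
  shows "(1\<^sub>m m \<otimes>\<^sub>K A + B\<^sup>T \<otimes>\<^sub>K 1\<^sub>m n) *\<^sub>v vectorize X = vectorize (A * X + X * B)"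
proof -
  have "(1\<^sub>m m \<otimes>\<^sub>K A + B\<^sup>T \<otimes>\<^sub>K 1\<^sub>m n) *\<^sub>v vectorize X =
      (1\<^sub>m m \<otimes>\<^sub>K A) *\<^sub>v vectorize X + (B\<^sup>T \<otimes>\<^sub>K 1\<^sub>m n) *\<^sub>v vectorize X"
    using kronecker_prod_carrier[of "1\<^sub>m m" m m A n n] kronecker_prod_carrier[of "B\<^sup>T" m m "1\<^sub>m n" n n]
      vectorize_carrier[OF X] A B
    by (intro add_mult_distrib_mat_vec[where nr = "m * n" and nc = "m * n"]) (auto simp: mult.commute)
  also have "\<dots> = vectorize (A * X) + vectorize (X * B)"
    using kronecker_prod_mult_vectorize[of "1\<^sub>m m" m m A n n X]
      kronecker_prod_mult_vectorize[of "B\<^sup>T" m m "1\<^sub>m n" n n X] A B X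
    by simp
  also have "\<dots> = vectorize (A * X + X * B)"
    using A B X by (intro vectorize_add[symmetric, where n = n and m = m]) auto
  finally show ?thesis .
qed

section \<open>Block Krylov spaces\<close>

text \<open>The recursion for powers appends factors on the right, while multiplying \<open>A^i C\<close> by \<open>A\<close>
  adds one on the left.\<close>

lemma pow_mat_Suc_left:
  assumes A: "(A :: 'a :: semiring_1 mat) \<in> carrier_mat n n"
  shows "A ^\<^sub>m Suc i = A * A ^\<^sub>m i"
proof (induction i)
  case 0
  then show ?case using A by simp
next
  case (Suc i)
  have "A ^\<^sub>m Suc (Suc i) = (A * A ^\<^sub>m i) * A" using Suc by simp
  also have "\<dots> = A * A ^\<^sub>m Suc i" using A by (simp add: assoc_mult_mat[of A n n _ n])
  finally show ?case .
qed

text \<open>Each column of \<open>M\<close> is \<open>V\<close> times some coefficient vector; these vectors are the columns of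
  the factor.\<close>

lemma factor_if_cols_in_span:
  assumes V: "(V :: real mat) \<in> carrier_mat n d" and M: "M \<in> carrier_mat n s"
    and sub: "set (cols M) \<subseteq> LinearCombinations.module.span class_ring (real_vec_space n) (set (cols V))"
  shows "\<exists>X \<in> carrier_mat d s. M = V * X"
proof -
  interpret vec_space "TYPE(real)" n .
  have "\<exists>x. x \<in> carrier_vec d \<and> V *\<^sub>v x = col M j" if "j < s" for j
  proof -
    have "col M j \<in> set (cols M)" using that M by (auto simp: cols_def)
    with sub have "col M j \<in> col_space V" by (auto simp: col_space_def)
    then show ?thesis using col_space_eq[OF V] V by auto
  qed
  then obtain x where x: "\<And>j. j < s \<Longrightarrow> x j \<in> carrier_vec d \<and> V *\<^sub>v x j = col M j"
    by metis
  define X where "X = mat_of_cols d (map x [0..<s])"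
  have X: "X \<in> carrier_mat d s"
    unfolding X_def using mat_of_cols_carrier(1)[of d "map x [0..<s]"] by simp
  have "M = V * X"
  proof (rule mat_col_eqI)
    fix j assume "j < dim_col (V * X)"
    then have j: "j < s" using X by simp
    have "col X j = x j" using x[OF j] j by (simp add: X_def)
    then show "col M j = col (V * X) j" using x[OF j] col_mult2[OF V X j] by simp
  qed (use M V X in auto)
  with X show ?thesis by blast
qed

lemma cols_pow_mult_subset_block_krylov_space:
  assumes A: "A \<in> carrier_mat n n" and C: "C \<in> carrier_mat n s" and i: "i < k"
  shows "set (cols (A ^\<^sub>m i * C)) \<subseteq> block_krylov_space k A C"
proof -
  interpret vec_space "TYPE(real)" n .
  let ?vs = "concat (map (\<lambda>j. cols (A ^\<^sub>m j * C)) [0..<k])"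
  have carr: "set (cols (A ^\<^sub>m j * C)) \<subseteq> carrier_vec n" for j
    using cols_dim[of "A ^\<^sub>m j * C"] A by simp
  then have vs: "set ?vs \<subseteq> carrier_vec n" by auto
  have "set (cols (A ^\<^sub>m i * C)) \<subseteq> set ?vs" using i by auto
  also have "\<dots> \<subseteq> span (set ?vs)" by (rule in_own_span[OF vs])
  also have "\<dots> = block_krylov_space k A C"
    using vs C by (simp add: block_krylov_space_def krylov_block_mat_def col_space_def)
  finally show ?thesis .
qed

lemma pow_mult_factors_through_basis:
  assumes "A \<in> carrier_mat n n" and "C \<in> carrier_mat n s" and "i < k"
    and V: "V \<in> carrier_mat n d" and basis: "cols_orthonormal_basis V (block_krylov_space k A C)"
  shows "\<exists>X \<in> carrier_mat d s. A ^\<^sub>m i * C = V * X"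
proof (rule factor_if_cols_in_span[OF V])
  show "A ^\<^sub>m i * C \<in> carrier_mat n s"
    using assms(1,2) by (metis mult_carrier_mat pow_carrier_mat)
  show "set (cols (A ^\<^sub>m i * C)) \<subseteq>
      LinearCombinations.module.span class_ring (real_vec_space n) (set (cols V))"
    using cols_pow_mult_subset_block_krylov_space[OF assms(1-3)] basis V
    by (simp add: cols_orthonormal_basis_def)
qed

section \<open>Matrices with prescribed column and row spaces\<close>

text \<open>The \<open>n \<times> m\<close> matrices whose columns lie in the column space of \<open>V\<close> and whose rows lie in the
  column space of \<open>W\<close>.\<close>

definition compressible :: "real mat \<Rightarrow> real mat \<Rightarrow> real mat set" where
  "compressible V W = {V * Y * W\<^sup>T | Y. Y \<in> carrier_mat (dim_col V) (dim_col W)}"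

lemma compressible_carrier:
  assumes "V \<in> carrier_mat n d" and "W \<in> carrier_mat m e" and "M \<in> compressible V W"
  shows "M \<in> carrier_mat n m"
  using assms by (auto simp: compressible_def)

lemma compressible_add:
  assumes "V \<in> carrier_mat n d" and "W \<in> carrier_mat m e"
    and "M \<in> compressible V W" and "N \<in> compressible V W"
  shows "M + N \<in> compressible V W"
proof -
  obtain Y Y' where Y: "Y \<in> carrier_mat d e" "M = V * Y * W\<^sup>T"
      and Y': "Y' \<in> carrier_mat d e" "N = V * Y' * W\<^sup>T"
    using assms by (auto simp: compressible_def)
  have "M + N = V * (Y + Y') * W\<^sup>T"
    using Y Y' assms(1,2)
    by (simp add: mult_add_distrib_mat[of V n d _ e] add_mult_distrib_mat[of _ n e _ _ m])
  then show ?thesis using Y Y' assms(1,2) by (auto simp: compressible_def)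
qed

lemma compressible_smult:
  assumes "V \<in> carrier_mat n d" and "W \<in> carrier_mat m e" and "M \<in> compressible V W"
  shows "c \<cdot>\<^sub>m M \<in> compressible V W"
proof -
  obtain Y where Y: "Y \<in> carrier_mat d e" "M = V * Y * W\<^sup>T"
    using assms by (auto simp: compressible_def)
  have "c \<cdot>\<^sub>m M = V * (c \<cdot>\<^sub>m Y) * W\<^sup>T"
    using Y assms(1,2)
    by (simp add: mult_smult_distrib[of V n d _ e] mult_smult_assoc_mat[of _ n e _ m])
  then show ?thesis using Y assms(1,2) by (auto simp: compressible_def)
qed

lemma compressible_zero:
  assumes "V \<in> carrier_mat n d" and "W \<in> carrier_mat m e"
  shows "0\<^sub>m n m \<in> compressible V W"
proof -
  have "0\<^sub>m n m = V * 0\<^sub>m d e * W\<^sup>T" using assms by simp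
  then show ?thesis using assms unfolding compressible_def by fastforce
qed

lemma compressible_outer_product:
  assumes V: "V \<in> carrier_mat n d" and W: "W \<in> carrier_mat m e"
    and X: "X \<in> carrier_mat d s" and Y: "Y \<in> carrier_mat e s"
  shows "(V * X) * (W * Y)\<^sup>T \<in> compressible V W"
proof -
  have "(V * X) * (W * Y)\<^sup>T = V * (X * Y\<^sup>T) * W\<^sup>T"
    using assms by (simp add: transpose_mult[OF W Y] assoc_mult_mat[of V n d X s _ e]
        assoc_mult_mat[of "V * X" n s "Y\<^sup>T" e "W\<^sup>T" m, symmetric])
  then show ?thesis using assms unfolding compressible_def by auto
qed

text \<open>A span is contained in any submodule that contains its generators, so this reduces the claim
  about the Krylov space to one about the vectors \<open>F^j c\<close>.\<close>

lemma submodule_vectorize_compressible: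
  assumes V: "V \<in> carrier_mat n d" and W: "W \<in> carrier_mat m e"
  shows "submodule class_ring (vectorize ` compressible V W) (real_vec_space (n * m))"
proof -
  note carr = compressible_carrier[OF V W]
  show ?thesis
  proof (rule LinearCombinations.submodule.intro, goal_cases)
    case 1
    show ?case by (rule vec_module)
  next
    case 2
    then show ?case using carr vectorize_carrier by (auto simp: module_vec_simps)
  next
    case (3 v w)
    then show ?case
      using carr compressible_add[OF V W] vectorize_add[of _ n m, symmetric]
      by (auto simp: module_vec_simps)
  next
    case 4
    then show ?case
      using compressible_zero[OF V W] vectorize_zero[of n m]
      by (auto simp: module_vec_simps intro!: image_eqI[of _ vectorize])
  next
    case (5 c v)
    then show ?case
      using carr compressible_smult[OF V W] vectorize_smult[of _ n m, symmetric]
      by (auto simp: module_vec_simps)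
  qed
qed

section \<open>Krylov spaces of the Kronecker sum\<close>

text \<open>Starting from an arbitrary \<open>M i l\<close> instead of \<open>M 0 0\<close> lets the induction on \<open>j\<close> close
  without binomial coefficients: apply \<open>F\<close> once, which gives \<open>M (i+1) l + M i (l+1)\<close>, and use the
  induction hypothesis on both summands. The invariant is that \<open>i + l + j\<close> does not change.\<close>

lemma kronecker_sum_power_compressible:
  fixes A B C1 C2 V W :: "real mat" and k m n :: nat
  defines "F \<equiv> 1\<^sub>m m \<otimes>\<^sub>K A + B\<^sup>T \<otimes>\<^sub>K 1\<^sub>m n"
    and "M \<equiv> (\<lambda>i l. (A ^\<^sub>m i * C1) * ((B\<^sup>T) ^\<^sub>m l * C2)\<^sup>T)"
  assumes A: "A \<in> carrier_mat n n" and B: "B \<in> carrier_mat m m"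
    and C1: "C1 \<in> carrier_mat n s" and C2: "C2 \<in> carrier_mat m s"
    and V: "V \<in> carrier_mat n d" and W: "W \<in> carrier_mat m e"
    and compr: "\<And>i l. i < k \<Longrightarrow> l < k \<Longrightarrow> M i l \<in> compressible V W"
    and "i + l + j < k"
  shows "(F ^\<^sub>m j) *\<^sub>v vectorize (M i l) \<in> vectorize ` compressible V W"
  using \<open>i + l + j < k\<close>
proof (induction j arbitrary: i l)
  have F: "F \<in> carrier_mat (n * m) (n * m)"
    unfolding F_def by (rule kronecker_sum_carrier[OF A B])
  have BT: "B\<^sup>T \<in> carrier_mat m m" using B by simp
  have P: "A ^\<^sub>m i * C1 \<in> carrier_mat n s" for i
    by (rule mult_carrier_mat[OF pow_carrier_mat[OF A] C1])
  have Q: "B\<^sup>T ^\<^sub>m l * C2 \<in> carrier_mat m s" for l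
    by (rule mult_carrier_mat[OF pow_carrier_mat[OF BT] C2])
  have QT: "(B\<^sup>T ^\<^sub>m l * C2)\<^sup>T \<in> carrier_mat s m" for l
    using Q by simp
  have M: "M i l \<in> carrier_mat n m" for i l
    unfolding M_def by (rule mult_carrier_mat[OF P QT])
  note vM = vectorize_carrier[OF M]
  {
    case 0
    then show ?case using F compr[of i l] vM[of i l] by simp
  next
    case (Suc j)
    have "A * (A ^\<^sub>m i * C1) = A ^\<^sub>m Suc i * C1"
      unfolding pow_mat_Suc_left[OF A]
      by (rule assoc_mult_mat[OF A pow_carrier_mat[OF A] C1, symmetric])
    then have AM: "A * M i l = M (Suc i) l"
      unfolding M_def assoc_mult_mat[OF A P QT, symmetric] by (rule arg_cong)
    have "B\<^sup>T ^\<^sub>m Suc l * C2 = B\<^sup>T * (B\<^sup>T ^\<^sub>m l * C2)"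
      unfolding pow_mat_Suc_left[OF BT] by (rule assoc_mult_mat[OF BT pow_carrier_mat[OF BT] C2])
    then have "(B\<^sup>T ^\<^sub>m Suc l * C2)\<^sup>T = (B\<^sup>T ^\<^sub>m l * C2)\<^sup>T * B"
      by (simp only: transpose_mult[OF BT Q] transpose_transpose)
    then have MB: "M i l * B = M i (Suc l)"
      unfolding M_def assoc_mult_mat[OF P QT B] by (simp only:)
    have "(F ^\<^sub>m Suc j) *\<^sub>v vectorize (M i l) = (F ^\<^sub>m j) *\<^sub>v (F *\<^sub>v vectorize (M i l))"
      using assoc_mult_mat_vec[OF pow_carrier_mat[OF F] F vM] by simp
    also have "F *\<^sub>v vectorize (M i l) = vectorize (M (Suc i) l) + vectorize (M i (Suc l))"
      unfolding F_def kronecker_sum_mult_vectorize[OF A B M] AM MB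
      by (rule vectorize_add[OF M M])
    also have "(F ^\<^sub>m j) *\<^sub>v (vectorize (M (Suc i) l) + vectorize (M i (Suc l))) =
        (F ^\<^sub>m j) *\<^sub>v vectorize (M (Suc i) l) + (F ^\<^sub>m j) *\<^sub>v vectorize (M i (Suc l))"
      by (rule mult_add_distrib_mat_vec[OF pow_carrier_mat[OF F] vM vM])
    also have "\<dots> \<in> vectorize ` compressible V W"
      using submodule.m_closed[OF submodule_vectorize_compressible[OF V W] Suc.IH Suc.IH,
          of "Suc i" l i "Suc l"] Suc.prems
      by (simp add: module_vec_simps)
    finally show ?case .
  }
qed

theorem corollary3p3:
  fixes n m s k :: nat and A B C1 C2 V W Z :: "real mat"
  assumes "n \<ge> 1" and "m \<ge> 1" and "s \<ge> 1" and "k \<ge> 1"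
    and "A \<in> carrier_mat n n" and "B \<in> carrier_mat m m"
    and "C1 \<in> carrier_mat n s" and "C2 \<in> carrier_mat m s"
    and "V \<in> carrier_mat n (k * s)" and "W \<in> carrier_mat m (k * s)"
    and "cols_orthonormal_basis V (block_krylov_space k A C1)"
    and "cols_orthonormal_basis W (block_krylov_space k B\<^sup>T C2)"
    and "Z \<in> carrier_mat n m"
    and "vectorize Z \<in>
      krylov_space k (1\<^sub>m m \<otimes>\<^sub>K A + B\<^sup>T \<otimes>\<^sub>K 1\<^sub>m n) (vectorize (C1 * C2\<^sup>T))"
  shows "\<exists>Y \<in> carrier_mat (k * s) (k * s). Z = V * Y * W\<^sup>T"
proof -
  note A = assms(5) and B = assms(6) and C1 = assms(7) and C2 = assms(8)
    and V = assms(9) and W = assms(10) and Z = assms(13)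
  let ?F = "1\<^sub>m m \<otimes>\<^sub>K A + B\<^sup>T \<otimes>\<^sub>K 1\<^sub>m n"
  let ?c = "vectorize (C1 * C2\<^sup>T)"
  let ?S = "vectorize ` compressible V W"
  interpret vec_space "TYPE(real)" "n * m" .
  have BT: "B\<^sup>T \<in> carrier_mat m m" using B by simp
  have compr: "(A ^\<^sub>m i * C1) * (B\<^sup>T ^\<^sub>m l * C2)\<^sup>T \<in> compressible V W" if il: "i < k" "l < k" for i l
  proof -
    obtain X where X: "X \<in> carrier_mat (k * s) s" "A ^\<^sub>m i * C1 = V * X"
      using pow_mult_factors_through_basis[OF A C1 il(1) V assms(11)] by blast
    obtain Y where Y: "Y \<in> carrier_mat (k * s) s" "B\<^sup>T ^\<^sub>m l * C2 = W * Y"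
      using pow_mult_factors_through_basis[OF BT C2 il(2) W assms(12)] by blast
    show ?thesis using compressible_outer_product[OF V W X(1) Y(1)] X(2) Y(2) by simp
  qed
  have "(?F ^\<^sub>m j) *\<^sub>v ?c \<in> ?S" if "j < k" for j
    using kronecker_sum_power_compressible[OF A B C1 C2 V W compr, of k 0 0 j] that A B C1 C2
    by simp
  then have "{(?F ^\<^sub>m j) *\<^sub>v ?c | j. j < k} \<subseteq> ?S" by blast
  then have "span {(?F ^\<^sub>m j) *\<^sub>v ?c | j. j < k} \<subseteq> ?S"
    by (rule span_is_subset[OF _ submodule_vectorize_compressible[OF V W]])
  moreover have "dim_vec ?c = n * m"
    using C1 C2 by (simp add: vectorize_def)
  ultimately have "vectorize Z \<in> ?S"
    using assms(14) by (auto simp: krylov_space_def)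
  then obtain Z' where Z': "Z' \<in> compressible V W" "vectorize Z = vectorize Z'" by blast
  have "Z = Z'"
    by (rule vectorize_inj[OF Z compressible_carrier[OF V W Z'(1)] Z'(2)])
  then show ?thesis using Z'(1) V W by (auto simp: compressible_def)
qed

end
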